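(* Let $X$ be a compact convex set and let $H$ be an intermediate function space on $X$ such that $H=H^{\uparrow}\cap H^{\downarrow}$ and $H^{\uparrow}$ is determined by extreme points. Let $$\mathcal A_H=\{[m>0]\cap\operatorname{ext}X: m\in M(H)\},\qquad \mathcal A_H^s=\{[m>0]\cap\operatorname{ext}X: m\in M^s(H)\}.$$ Then: (i) $M(H)=M(H)^{\uparrow}\cap M(H)^{\downarrow}$ and $M^s(H)=M^s(H)^{\uparrow}\cap M^s(H)^{\downarrow}$. (ii) A bounded function on $\operatorname{ext}X$ can be extended to an element of $M(H)$ if and only if it is $\mathcal A_H$-measurable. (iii) A bounded function on $\operatorname{ext}X$ can be extended to an element of $M^s(H)$ if and only if it is $\mathcal A_H^s$-measurable.
   Context: A compact convex set is a compact convex subset of a (Hausdorff) locally convex real topological vector space; $\operatorname{ext}X$ is the set of its extreme points. $A_c(X)$ is the space of continuous affine real functions on $X$ and $A_b(X)$ the space of bounded affine real functions on $X$ with the supremum norm. An intermediate function space on $X$ is a (norm-)closed linear subspace $H\subset A_b(X)$ with $A_c(X)\subset H$. A family $F$ of bounded functions on $X$ is determined by extreme points if $\inf u(\operatorname{ext}X)\le u\le\sup u(\operatorname{ext}X)$ for every $u\in F$. For a family $F$ of bounded functions on $X$, $F^\uparrow$ (resp. $F^\downarrow$) is the set of all pointwise limits of bounded non-decreasing (resp. non-increasing) sequences from $F$. $M_1(X)$ is the set of (complete) Radon probability measures on $X$. For $\mu,\nu\in M_1(X)$, $\mu\prec\nu$ means $\int f\,d\mu\le\int f\,d\nu$ for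 every convex continuous $f:X\to\mathbb R$; $\mu\in M_1(X)$ is maximal if it is maximal with respect to $\prec$. Multipliers: $M(H)=\{u\in H:\forall a\in H\ \exists b\in H\colon b=u\cdot a\text{ on }\operatorname{ext}X\}$. Strong multipliers: $M^s(H)=\{u\in H:\forall a\in H\ \exists b\in H\colon b=u\cdot a\ \mu\text{-almost everywhere for each maximal }\mu\in M_1(X)\}$. Here $[m>0]=\{x\in X:m(x)>0\}$. For a family $\mathcal A$ of subsets of $\operatorname{ext}X$, a function $f:\operatorname{ext}X\to\mathbb R$ is $\mathcal A$-measurable if $f^{-1}(U)\in\mathcal A$ for each open $U\subset\mathbb R$. *)

theory Defs
  imports "HOL-Analysis.Analysis"
begin

text \<open>
  The last clause of the second axiom is convexity of \<open>V\<close>, written out because the constant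
  \<open>convex\<close> is not available inside a class specification.
\<close>

class hausdorff_lcs = real_vector + topological_ab_group_add + t2_space +
  assumes tendsto_scaleR_Pair:
    "LIM x (nhds (c::real) \<times>\<^sub>F nhds a). fst x *\<^sub>R snd x :> nhds (c *\<^sub>R a)"
  and locally_convex_at_0:
    "\<lbrakk>open U; 0 \<in> U\<rbrakk> \<Longrightarrow> \<exists>V. open V \<and> 0 \<in> V \<and> V \<subseteq> U \<and>
       (\<forall>x\<in>V. \<forall>y\<in>V. \<forall>t\<ge>0. t \<le> 1 \<longrightarrow> (1 - t) *\<^sub>R x + t *\<^sub>R y \<in> V)"

definition ext_pts :: "'a::real_vector set \<Rightarrow> 'a set" where
  "ext_pts X = {x. x extreme_point_of X}"

section \<open>Spaces of affine functions\<close>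

text \<open>
  A real function on \<open>X\<close> is represented by the total function that extends it by \<open>0\<close>
  outside \<open>X\<close>, so that equality, pointwise order and pointwise limits of representatives
  are equality, pointwise order and pointwise limits on \<open>X\<close>.
\<close>

definition affine_function_on :: "'a::real_vector set \<Rightarrow> ('a \<Rightarrow> real) \<Rightarrow> bool" where
  "affine_function_on X u \<longleftrightarrow>
     (\<forall>x\<in>X. \<forall>y\<in>X. \<forall>t\<in>{0..1}. u ((1 - t) *\<^sub>R x + t *\<^sub>R y) = (1 - t) * u x + t * u y)"

definition A_b :: "'a::real_vector set \<Rightarrow> ('a \<Rightarrow> real) set" where
  "A_b X = {u. (\<forall>x. x \<notin> X \<longrightarrow> u x = 0) \<and> affine_function_on X u \<and> bounded (u ` X)}"

definition A_c :: "'a::{real_vector, topological_space} set \<Rightarrow> ('a \<Rightarrow> real) set" where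
  "A_c X = {u. (\<forall>x. x \<notin> X \<longrightarrow> u x = 0) \<and> affine_function_on X u \<and> continuous_on X u}"

definition intermediate_function_space ::
    "'a::{real_vector, topological_space} set \<Rightarrow> ('a \<Rightarrow> real) set \<Rightarrow> bool" where
  "intermediate_function_space X H \<longleftrightarrow>
     A_c X \<subseteq> H \<and> H \<subseteq> A_b X \<and>
     (\<forall>u\<in>H. \<forall>v\<in>H. (\<lambda>x. u x + v x) \<in> H) \<and>
     (\<forall>c. \<forall>u\<in>H. (\<lambda>x. c * u x) \<in> H) \<and>
     (\<forall>u f. (\<forall>n. u n \<in> H) \<longrightarrow> f \<in> A_b X \<longrightarrow> uniform_limit X u f sequentially \<longrightarrow> f \<in> H)"

definition determined_by_extreme_points ::
    "'a::real_vector set \<Rightarrow> ('a \<Rightarrow> real) set \<Rightarrow> bool" where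
  "determined_by_extreme_points X F \<longleftrightarrow>
     (\<forall>u\<in>F. \<forall>x\<in>X. Inf (u ` ext_pts X) \<le> u x \<and> u x \<le> Sup (u ` ext_pts X))"

definition up :: "('a \<Rightarrow> real) set \<Rightarrow> ('a \<Rightarrow> real) set" where
  "up F = {f. \<exists>u::nat \<Rightarrow> 'a \<Rightarrow> real. (\<forall>n. u n \<in> F) \<and> incseq u \<and>
             (\<exists>C. \<forall>n x. \<bar>u n x\<bar> \<le> C) \<and> (\<forall>x. (\<lambda>n. u n x) \<longlonglongrightarrow> f x)}"

definition down :: "('a \<Rightarrow> real) set \<Rightarrow> ('a \<Rightarrow> real) set" where
  "down F = {f. \<exists>u::nat \<Rightarrow> 'a \<Rightarrow> real. (\<forall>n. u n \<in> F) \<and> decseq u \<and>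
               (\<exists>C. \<forall>n x. \<bar>u n x\<bar> \<le> C) \<and> (\<forall>x. (\<lambda>n. u n x) \<longlonglongrightarrow> f x)}"

section \<open>Radon measures and the Choquet order\<close>

text \<open>
  The domain of a complete Radon measure is not prescribed: it contains the Borel subsets
  of \<open>X\<close>, and completeness together with inner regularity on the whole domain forces it to
  be the completion of the Borel sigma-algebra. Equality of two such measures is therefore
  equality on Borel sets.
\<close>

definition M_1 :: "'a::topological_space set \<Rightarrow> 'a measure set" where
  "M_1 X = {\<mu>. space \<mu> = X \<and> sets (restrict_space borel X) \<subseteq> sets \<mu> \<and>
               emeasure \<mu> X = 1 \<and> complete_measure \<mu> \<and>
               (\<forall>B\<in>sets \<mu>. emeasure \<mu> B = (SUP K\<in>{K. compact K \<and> K \<subseteq> B}. emeasure \<mu> K))}"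

definition choquet_le ::
    "'a::{real_vector, topological_space} set \<Rightarrow> 'a measure \<Rightarrow> 'a measure \<Rightarrow> bool" where
  "choquet_le X \<mu> \<nu> \<longleftrightarrow>
     (\<forall>f. convex_on X f \<longrightarrow> continuous_on X f \<longrightarrow> (\<integral>x. f x \<partial>\<mu>) \<le> (\<integral>x. f x \<partial>\<nu>))"

definition maximal_measure :: "'a::{real_vector, topological_space} set \<Rightarrow> 'a measure \<Rightarrow> bool" where
  "maximal_measure X \<mu> \<longleftrightarrow> \<mu> \<in> M_1 X \<and> (\<forall>\<nu>\<in>M_1 X. choquet_le X \<mu> \<nu> \<longrightarrow> \<nu> = \<mu>)"

section \<open>Multipliers\<close>

definition multipliers :: "'a::real_vector set \<Rightarrow> ('a \<Rightarrow> real) set \<Rightarrow> ('a \<Rightarrow> real) set" where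
  "multipliers X H = {u\<in>H. \<forall>a\<in>H. \<exists>b\<in>H. \<forall>x\<in>ext_pts X. b x = u x * a x}"

definition strong_multipliers ::
    "'a::{real_vector, topological_space} set \<Rightarrow> ('a \<Rightarrow> real) set \<Rightarrow> ('a \<Rightarrow> real) set" where
  "strong_multipliers X H =
     {u\<in>H. \<forall>a\<in>H. \<exists>b\<in>H. \<forall>\<mu>. maximal_measure X \<mu> \<longrightarrow> (AE x in \<mu>. b x = u x * a x)}"

definition positivity_sets :: "'a::real_vector set \<Rightarrow> ('a \<Rightarrow> real) set \<Rightarrow> 'a set set" where
  "positivity_sets X M = {{x\<in>X. m x > 0} \<inter> ext_pts X | m. m \<in> M}"

definition family_measurable :: "'a set \<Rightarrow> 'a set set \<Rightarrow> ('a \<Rightarrow> real) \<Rightarrow> bool" where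
  "family_measurable E \<A> f \<longleftrightarrow> (\<forall>U. open U \<longrightarrow> {x\<in>E. f x \<in> U} \<in> \<A>)"

definition extends_to :: "'a set \<Rightarrow> ('a \<Rightarrow> real) set \<Rightarrow> ('a \<Rightarrow> real) \<Rightarrow> bool" where
  "extends_to E M f \<longleftrightarrow> (\<exists>m\<in>M. \<forall>x\<in>E. m x = f x)"

end

(*
Multiplying by u is uniformly continuous and, for nonnegative factors, monotone on ext X, and elements
of H (and of its increasing limits) are controlled by their values on ext X. Hence M(H) is complete
under uniform limits and under two-sided monotone limits, which is (i), and its traces on ext X form
a uniformly closed algebra, stable under composition with continuous functions; this gives
measurability in (ii). Conversely, if the positivity sets of a, b >= 0 cover ext X, then a / (a + b)
is the monotone limit of a / (a + b + 1/n) from below and of 1 - b / (a + b + 1/n) from above, so it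
extends by (i); sums of such separating functions approximate a bounded measurable function uniformly.
Strong multipliers are handled by the same argument because Dirac measures at extreme points are
maximal, so that an identity holding almost everywhere for all maximal measures holds on ext X.
*)

theory Submission
  imports Defs "HOL-Probability.Giry_Monad"
begin

section \<open>Gauges in a locally convex space\<close>

lemma tendsto_scaleR_lcs:
  fixes g :: "'b \<Rightarrow> 'a::hausdorff_lcs"
  assumes "(f \<longlongrightarrow> c) F" "(g \<longlongrightarrow> a) F"
  shows "((\<lambda>x. f x *\<^sub>R g x) \<longlongrightarrow> c *\<^sub>R a) F"
  using filterlim_compose[OF tendsto_scaleR_Pair filterlim_Pair[OF assms]] by simp

lemma continuous_on_scaleR_lcs:
  fixes g :: "'b::topological_space \<Rightarrow> 'a::hausdorff_lcs"
  assumes "continuous_on S f" "continuous_on S g"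
  shows "continuous_on S (\<lambda>x. f x *\<^sub>R g x)"
  using assms tendsto_scaleR_lcs by (fastforce simp: continuous_on_def)

text \<open>The Minkowski functional (gauge) of \<open>V\<close>. As \<open>V\<close> may be
  asymmetric, it is sublinear rather than a seminorm, and \<open>y - z\<close> has to be told apart
  from \<open>z - y\<close>.\<close>

definition minkowski :: "'a::real_vector set \<Rightarrow> 'a \<Rightarrow> real" where
  "minkowski V y = Inf {t. 0 < t \<and> (1 / t) *\<^sub>R y \<in> V}"

context
  fixes V :: "'a::hausdorff_lcs set"
  assumes V: "open V" "0 \<in> V" "convex V"
begin

section \<open>Sublinearity of the gauge\<close>

text \<open>Continuity of scalar multiplication sends \<open>y / (n + 1)\<close> to 0. This keeps
  the infimum in \<open>minkowski\<close> from being taken over the empty set.\<close>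

lemma absorbing: "\<exists>t>0. (1 / t) *\<^sub>R y \<in> V"
proof -
  have "((\<lambda>n. inverse (real (Suc n)) *\<^sub>R y) \<longlongrightarrow> 0 *\<^sub>R y) sequentially"
    by (intro tendsto_scaleR_lcs LIMSEQ_inverse_real_of_nat tendsto_const)
  then have "\<forall>\<^sub>F n in sequentially. inverse (real (Suc n)) *\<^sub>R y \<in> V"
    using V topological_tendstoD by fastforce
  then obtain n where "inverse (real (Suc n)) *\<^sub>R y \<in> V"
    by (meson eventually_sequentially order_refl)
  then show ?thesis
    by (intro exI[of _ "real (Suc n)"]) (simp add: inverse_eq_divide)
qed

lemma minkowski_le: "0 < t \<Longrightarrow> (1 / t) *\<^sub>R y \<in> V \<Longrightarrow> minkowski V y \<le> t"
  unfolding minkowski_def by (rule cInf_lower) (auto intro: bdd_belowI[of _ 0])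

lemma minkowski_nonneg: "0 \<le> minkowski V y"
  unfolding minkowski_def using absorbing by (intro cInf_greatest) auto

text \<open>Some \<open>s < t\<close> has \<open>y / s\<close> in \<open>V\<close>, and
  \<open>y / t\<close> lies on the segment from 0 to that point.\<close>

lemma scale_mem_of_minkowski_less:
  assumes "minkowski V y < t"
  shows "(1 / t) *\<^sub>R y \<in> V"
proof -
  obtain s where s: "0 < s" "(1 / s) *\<^sub>R y \<in> V" "s < t"
    using assms absorbing cInf_lessD[of "{t. 0 < t \<and> (1 / t) *\<^sub>R y \<in> V}" t]
    unfolding minkowski_def by blast
  have "(s / t) *\<^sub>R ((1 / s) *\<^sub>R y) + (1 - s / t) *\<^sub>R 0 \<in> V"
    using s V by (intro convexD) auto
  then show ?thesis using s by simp
qed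

lemma minkowski_zero: "minkowski V 0 = 0"
proof (rule antisym[OF field_le_epsilon minkowski_nonneg])
  show "minkowski V 0 \<le> 0 + e" if "0 < e" for e
    using minkowski_le[of e 0] that V by simp
qed

lemma minkowski_ge_1: "y \<notin> V \<Longrightarrow> 1 \<le> minkowski V y"
  using scale_mem_of_minkowski_less[of y 1] by force

text \<open>For \<open>s\<close>, \<open>t\<close> slightly above the two gauges,
  \<open>(x + y) / (s + t)\<close> is a convex combination of \<open>x / s\<close> and
  \<open>y / t\<close>.\<close>

lemma minkowski_add: "minkowski V (x + y) \<le> minkowski V x + minkowski V y"
proof (rule field_le_epsilon)
  fix e :: real assume "0 < e"
  define s t where "s = minkowski V x + e / 2" and "t = minkowski V y + e / 2"
  have st: "0 < s" "0 < t"
    using minkowski_nonneg[of x] minkowski_nonneg[of y] \<open>0 < e\<close> by (auto simp: s_def t_def)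
  have "(1 / s) *\<^sub>R x \<in> V" "(1 / t) *\<^sub>R y \<in> V"
    using \<open>0 < e\<close> by (auto intro!: scale_mem_of_minkowski_less simp: s_def t_def)
  moreover have "s / (s + t) + t / (s + t) = 1"
    using st by (simp flip: add_divide_distrib)
  ultimately have "(s / (s + t)) *\<^sub>R ((1 / s) *\<^sub>R x) + (t / (s + t)) *\<^sub>R ((1 / t) *\<^sub>R y) \<in> V"
    using st by (intro convexD[OF V(3)]) auto
  then have "(1 / (s + t)) *\<^sub>R (x + y) \<in> V"
    using st by (simp add: scaleR_add_right)
  then have "minkowski V (x + y) \<le> s + t"
    using st by (intro minkowski_le) auto
  then show "minkowski V (x + y) \<le> minkowski V x + minkowski V y + e"
    by (simp add: s_def t_def)
qed

lemma minkowski_scale: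
  assumes "0 \<le> c"
  shows "minkowski V (c *\<^sub>R y) \<le> c * minkowski V y"
proof (cases "c = 0")
  case False
  then have c: "0 < c" using assms by simp
  show ?thesis
  proof (rule field_le_epsilon)
    fix e :: real assume e: "0 < e"
    define s where "s = minkowski V y + e / c"
    have s: "minkowski V y < s" "0 < s"
      using minkowski_nonneg[of y] e c by (auto simp: s_def intro: add_nonneg_pos)
    have "minkowski V (c *\<^sub>R y) \<le> c * s"
      using scale_mem_of_minkowski_less[OF s(1)] s c by (intro minkowski_le) auto
    then show "minkowski V (c *\<^sub>R y) \<le> c * minkowski V y + e"
      using c by (simp add: s_def distrib_left)
  qed
qed (simp add: minkowski_zero)

section \<open>Continuity of the gauge and convexity of its balls\<close>

lemma minkowski_tendsto_zero: "(minkowski V \<longlongrightarrow> 0) (nhds 0)"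
proof (rule order_tendstoI)
  fix e :: real assume e: "0 < e"
  \<comment> \<open>The factor \<open>2 / e\<close> bounds the gauge near 0 by \<open>e / 2\<close>,
    hence strictly below \<open>e\<close>.\<close>
  have "((\<lambda>y. (2 / e) *\<^sub>R y) \<longlongrightarrow> (2 / e) *\<^sub>R 0) (nhds (0 :: 'a))"
    by (intro tendsto_scaleR_lcs tendsto_const filterlim_ident)
  then have "\<forall>\<^sub>F y in nhds 0. (2 / e) *\<^sub>R y \<in> V"
    using V topological_tendstoD by fastforce
  then show "\<forall>\<^sub>F y in nhds 0. minkowski V y < e"
    by eventually_elim (use minkowski_le[of "e / 2"] e in fastforce)
qed (use minkowski_nonneg in \<open>auto intro: always_eventually less_le_trans\<close>)

text \<open>Exchanging \<open>y\<close> and \<open>z\<close> bounds the distance of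
  \<open>h y\<close> and \<open>h z\<close> by the sum of the gauges of \<open>z - y\<close> and
  \<open>y - z\<close>, which tends to 0.\<close>

lemma continuous_if_minkowski_bounded:
  fixes h :: "'a \<Rightarrow> real"
  assumes h: "\<And>y z. h y \<le> h z + minkowski V (z - y)"
  shows "continuous_on S h"
  unfolding continuous_on_def
proof
  fix y
  have d: "((\<lambda>z. z - y) \<longlongrightarrow> 0) (at y within S)" "((\<lambda>z. y - z) \<longlongrightarrow> 0) (at y within S)"
    using tendsto_diff[OF tendsto_ident_at[of y S] tendsto_const[of y]]
      tendsto_diff[OF tendsto_const[of y] tendsto_ident_at[of y S]] by simp_all
  have *: "((\<lambda>z. minkowski V (z - y) + minkowski V (y - z)) \<longlongrightarrow> 0 + 0) (at y within S)"
    by (intro tendsto_add filterlim_compose[OF minkowski_tendsto_zero] d)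
  have "\<bar>h z - h y\<bar> \<le> minkowski V (z - y) + minkowski V (y - z)" for z
    using h[of y z] h[of z y] minkowski_nonneg[of "z - y"] minkowski_nonneg[of "y - z"] by linarith
  then have "\<forall>\<^sub>F z in at y within S. norm (h z - h y) \<le> minkowski V (z - y) + minkowski V (y - z)"
    by simp
  then have "((\<lambda>z. h z - h y) \<longlongrightarrow> 0) (at y within S)"
    by (rule Lim_null_comparison) (use * in simp)
  then show "(h \<longlongrightarrow> h y) (at y within S)"
    by (rule LIM_zero_cancel)
qed

lemma continuous_on_minkowski: "continuous_on S (\<lambda>z. minkowski V (z - y))"
proof -
  \<comment> \<open>For the negated gauge, subadditivity gives the one-sided estimate with the
    required argument \<open>z - y\<close>; for the gauge itself it gives
    \<open>y - z\<close>.\<close>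
  have "continuous_on UNIV (\<lambda>z. - minkowski V z)"
  proof (rule continuous_if_minkowski_bounded)
    show "- minkowski V y \<le> - minkowski V z + minkowski V (z - y)" for y z
      using minkowski_add[of y "z - y"] by simp
  qed
  then have "continuous_on UNIV (\<lambda>z. minkowski V z)"
    using continuous_on_minus by fastforce
  then show ?thesis
    by (rule continuous_on_compose2[of UNIV _ S "\<lambda>z. z - y"])
      (simp_all add: continuous_on_diff)
qed

lemma minkowski_convex_comb:
  assumes "0 \<le> s" "0 \<le> t"
  shows "minkowski V (s *\<^sub>R x + t *\<^sub>R y) \<le> s * minkowski V x + t * minkowski V y"
  using minkowski_add[of "s *\<^sub>R x" "t *\<^sub>R y"] minkowski_scale[of s x] minkowski_scale[of t y] assms by linarith

lemma convex_minkowski_ball: "convex {z. minkowski V (z - y) \<le> r}"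
proof (rule convexI, unfold mem_Collect_eq)
  fix a b and u v :: real
  assume *: "minkowski V (a - y) \<le> r" "minkowski V (b - y) \<le> r" "0 \<le> u" "0 \<le> v" "u + v = 1"
  have "u *\<^sub>R (a - y) + v *\<^sub>R (b - y) = u *\<^sub>R a + v *\<^sub>R b - (u + v) *\<^sub>R y"
    by (simp add: algebra_simps)
  then have eq: "u *\<^sub>R (a - y) + v *\<^sub>R (b - y) = u *\<^sub>R a + v *\<^sub>R b - y"
    unfolding \<open>u + v = 1\<close> by simp
  have "minkowski V (u *\<^sub>R (a - y) + v *\<^sub>R (b - y)) \<le> u * minkowski V (a - y) + v * minkowski V (b - y)"
    using * by (intro minkowski_convex_comb)
  also have "\<dots> \<le> u * r + v * r"
    using * by (intro add_mono mult_left_mono)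
  also have "\<dots> = r" using * by (simp flip: distrib_right)
  finally show "minkowski V (u *\<^sub>R a + v *\<^sub>R b - y) \<le> r" unfolding eq .
qed

end

lemma open_convex_subset:
  fixes U :: "'a::hausdorff_lcs set"
  assumes "open U" "0 \<in> U"
  obtains V where "open V" "0 \<in> V" "convex V" "V \<subseteq> U"
  using locally_convex_at_0[OF assms] by (auto simp: convex_alt)

section \<open>Dirac measures at extreme points are maximal\<close>

text \<open>The weights are divided by their sum; if it is 0, both vanish and any point of
  \<open>S\<close> serves.\<close>

lemma convex_combine_scaled:
  assumes "convex S" "x \<in> S" "y \<in> S" "0 \<le> a" "0 \<le> b"
  shows "\<exists>z\<in>S. a *\<^sub>R x + b *\<^sub>R y = (a + b) *\<^sub>R z"
proof (cases "a + b = 0")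
  case False
  then have "(a / (a + b)) *\<^sub>R x + (b / (a + b)) *\<^sub>R y \<in> S"
    using assms by (intro convexD) (auto simp flip: add_divide_distrib)
  then show ?thesis
    using False by (intro bexI) (auto simp: scaleR_add_right)
qed (use assms in \<open>auto simp: add_nonneg_eq_0_iff\<close>)

text \<open>The largest weight \<open>l\<close> in a representation \<open>y = l k + (1 - l) z\<close> with \<open>k\<close> in \<open>K\<close> and \<open>z\<close>
  in \<open>X\<close> is a concave function of \<open>y\<close> that vanishes at an extreme point outside \<open>K\<close>. Penalizing the
  error of the representation by a gauge makes it continuous, which avoids Hahn-Banach.\<close>

lemma concave_separation:
  fixes K X :: "'a::hausdorff_lcs set"
  assumes K: "compact K" "convex K" "K \<noteq> {}" "K \<subseteq> X" and X: "compact X" "convex X"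
    and x: "x extreme_point_of X" "x \<notin> K" and e: "0 < e"
  obtains h :: "'a \<Rightarrow> real" where "continuous_on X h" "convex_on X (\<lambda>y. - h y)"
    "\<And>y. y \<in> K \<Longrightarrow> 1 \<le> h y" "\<And>y. y \<in> X \<Longrightarrow> 0 \<le> h y" "\<And>y. h y \<le> 1" "h x \<le> e"
proof -
  have "x \<in> X" using x by (simp add: extreme_point_of_def)
  \<comment> \<open>\<open>C\<close> consists of the points represented with weight at least
    \<open>min e 1\<close>. It is compact as a continuous image.\<close>
  define cc :: "real \<times> 'a \<times> 'a \<Rightarrow> 'a" where "cc = (\<lambda>(l, k, z). l *\<^sub>R k + (1 - l) *\<^sub>R z)"
  define C where "C = cc ` ({min e 1..1} \<times> K \<times> X)"
  have "continuous_on S cc" for S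
    unfolding cc_def case_prod_unfold
    by (intro continuous_on_add continuous_on_scaleR_lcs continuous_intros)
  then have "compact C"
    unfolding C_def using K X by (intro compact_continuous_image compact_Times) auto
  then have "closed C" by (rule compact_imp_closed)
  \<comment> \<open>Weight 1 would put \<open>x\<close> in \<open>K\<close>; a weight strictly
    between 0 and 1 would put it inside an open segment with endpoints in \<open>X\<close>.\<close>
  have "x \<notin> C"
  proof
    assume "x \<in> C"
    then obtain l k z where "min e 1 \<le> l"
      and lkz: "l \<le> 1" "k \<in> K" "z \<in> X" "x = l *\<^sub>R k + (1 - l) *\<^sub>R z"
      unfolding C_def cc_def by auto
    then have "0 < l" using e by linarith
    have "x \<noteq> k" using x lkz by auto
    then have l: "l \<noteq> 1" and "z \<noteq> k"
      using lkz by (auto simp flip: scaleR_add_left)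
    then have "x \<in> open_segment z k"
      using lkz \<open>0 < l\<close> by (auto simp: in_segment intro!: exI[of _ l])
    then show False using x lkz K by (auto simp: extreme_point_of_def)
  qed
  \<comment> \<open>For every \<open>c\<close> in \<open>C\<close> the difference
    \<open>x - c\<close> lies outside \<open>U\<close>, hence outside \<open>V\<close>, so its gauge
    is at least 1.\<close>
  define U where "U = {v. x - v \<notin> C}"
  have "U = (\<lambda>v. x - v) -` (- C)" by (auto simp: U_def)
  also have "open \<dots>"
    using \<open>closed C\<close> by (intro open_vimage) (auto intro!: continuous_intros)
  finally have "open U" .
  moreover have "0 \<in> U" using \<open>x \<notin> C\<close> by (simp add: U_def)
  ultimately obtain V where V: "open V" "0 \<in> V" "convex V" "V \<subseteq> U"
    by (rule open_convex_subset)
  note V3 = V(1-3)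
  \<comment> \<open>Pairs of a weight and the point represented with it. Convexity of
    \<open>D\<close> will make the supremum \<open>h\<close> concave.\<close>
  define D where "D = {(l, l *\<^sub>R k + (1 - l) *\<^sub>R z) |l k z. 0 \<le> l \<and> l \<le> 1 \<and> k \<in> K \<and> z \<in> X}"
  have DE: "\<exists>k\<in>K. \<exists>z\<in>X. 0 \<le> l \<and> l \<le> 1 \<and> c = l *\<^sub>R k + (1 - l) *\<^sub>R z" if "(l, c) \<in> D" for l c
    using that by (auto simp: D_def)
  \<comment> \<open>The \<open>K\<close>-parts of the two representations merge into one point of
    \<open>K\<close> with total weight \<open>n\<close>, the \<open>X\<close>-parts into one point
    of \<open>X\<close> with weight \<open>1 - n\<close>.\<close>
  have D_convex: "(1 - t) *\<^sub>R v + t *\<^sub>R w \<in> D" if t: "0 < t" "t < 1" and vw: "v \<in> D" "w \<in> D" for t v w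
  proof -
    obtain l k z m j y where v: "v = (l, l *\<^sub>R k + (1 - l) *\<^sub>R z)" "0 \<le> l" "l \<le> 1" "k \<in> K" "z \<in> X"
      and w: "w = (m, m *\<^sub>R j + (1 - m) *\<^sub>R y)" "0 \<le> m" "m \<le> 1" "j \<in> K" "y \<in> X"
      using vw by (auto simp: D_def)
    define n where "n = (1 - t) * l + t * m"
    have n': "1 - n = (1 - t) * (1 - l) + t * (1 - m)" by (simp add: n_def algebra_simps)
    obtain i where i: "i \<in> K" "((1 - t) * l) *\<^sub>R k + (t * m) *\<^sub>R j = n *\<^sub>R i"
      using convex_combine_scaled[OF K(2), of k j "(1 - t) * l" "t * m"] v w t by (auto simp: n_def)
    obtain x where x: "x \<in> X" "((1 - t) * (1 - l)) *\<^sub>R z + (t * (1 - m)) *\<^sub>R y = (1 - n) *\<^sub>R x"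
      using convex_combine_scaled[OF X(2), of z y "(1 - t) * (1 - l)" "t * (1 - m)"] v w t by (auto simp: n')
    have "(1 - t) *\<^sub>R v + t *\<^sub>R w = (n, n *\<^sub>R i + (1 - n) *\<^sub>R x)"
      unfolding i(2)[symmetric] x(2)[symmetric] by (simp add: v w n_def scaleR_add_right ac_simps)
    moreover have "0 \<le> n" using v w t by (simp add: n_def)
    moreover have "0 \<le> 1 - n" unfolding n' using v w t by simp
    ultimately show ?thesis using i x by (auto simp: D_def)
  qed
  define f where "f y w = fst w - minkowski V (y - snd w)" for y and w :: "real \<times> 'a"
  define h where "h y = (SUP w\<in>D. f y w)" for y
  \<comment> \<open>Weight 1 represents points of \<open>K\<close> and weight 0 points of
    \<open>X\<close>, both without penalty; this yields the lower bounds 1 and 0 for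
    \<open>h\<close>.\<close>
  have DK: "(1, k) \<in> D" if "k \<in> K" for k using that \<open>x \<in> X\<close> by (force simp: D_def)
  have DX: "(0, z) \<in> D" if "z \<in> X" for z using that K by (force simp: D_def)
  then have "D \<noteq> {}" using \<open>x \<in> X\<close> by blast
  have f_le: "f y w \<le> 1" if "w \<in> D" for y w
    using DE[of "fst w" "snd w"] minkowski_nonneg[OF V3, of "y - snd w"] that by (auto simp: f_def)
  then have bdd: "bdd_above (f y ` D)" for y by (auto intro!: bdd_aboveI2)
  have fh: "f y w \<le> h y" if "w \<in> D" for y w
    unfolding h_def using that bdd by (intro cSUP_upper)
  have h_le: "h y \<le> c" if "\<And>w. w \<in> D \<Longrightarrow> f y w \<le> c" for y c
    unfolding h_def using \<open>D \<noteq> {}\<close> that by (intro cSUP_least)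
  show thesis
  proof
    \<comment> \<open>By the triangle inequality, replacing \<open>y\<close> by \<open>z\<close>
      raises each penalty by at most the gauge of \<open>z - y\<close>.\<close>
    have "h y \<le> h z + minkowski V (z - y)" for y z
    proof (rule h_le)
      fix w assume "w \<in> D"
      have "minkowski V (z - snd w) \<le> minkowski V (z - y) + minkowski V (y - snd w)"
        using minkowski_add[OF V3, of "z - y" "y - snd w"] by simp
      then show "f y w \<le> h z + minkowski V (z - y)"
        using fh[OF \<open>w \<in> D\<close>, of z] by (simp add: f_def)
    qed
    then show "continuous_on X h" by (rule continuous_if_minkowski_bounded[OF V3])
    show "convex_on X (\<lambda>y. - h y)"
    proof (rule convex_onI)
      fix t y z assume t: "0 < t" "t < (1 :: real)"
      \<comment> \<open>Averaging two pairs averages their weights, and convexity of the gauge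
        controls the penalty. Suprema are then taken over \<open>v\<close> and over \<open>w\<close>
        in turn.\<close>
      have 1: "(1 - t) * f y v + t * f z w \<le> h ((1 - t) *\<^sub>R y + t *\<^sub>R z)" if "v \<in> D" "w \<in> D" for v w
      proof -
        define u where "u = (1 - t) *\<^sub>R v + t *\<^sub>R w"
        have "u \<in> D"
          unfolding u_def using t that by (intro D_convex)
        have eq: "((1 - t) *\<^sub>R y + t *\<^sub>R z) - snd u = (1 - t) *\<^sub>R (y - snd v) + t *\<^sub>R (z - snd w)"
          by (simp add: u_def algebra_simps)
        have "(1 - t) * f y v + t * f z w \<le> f ((1 - t) *\<^sub>R y + t *\<^sub>R z) u"
          using minkowski_convex_comb[OF V3, of "1 - t" t "y - snd v" "z - snd w"] t
          unfolding f_def eq by (simp add: u_def algebra_simps)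
        then show ?thesis using fh[OF \<open>u \<in> D\<close>] by (rule order_trans)
      qed
      have 2: "(1 - t) * h y + t * f z w \<le> h ((1 - t) *\<^sub>R y + t *\<^sub>R z)" if "w \<in> D" for w
      proof -
        have "h y \<le> (h ((1 - t) *\<^sub>R y + t *\<^sub>R z) - t * f z w) / (1 - t)"
          using 1 that t by (intro h_le) (simp add: pos_le_divide_eq mult.commute algebra_simps)
        then show ?thesis using t by (simp add: pos_le_divide_eq algebra_simps)
      qed
      have "h z \<le> (h ((1 - t) *\<^sub>R y + t *\<^sub>R z) - (1 - t) * h y) / t"
        using 2 t by (intro h_le) (simp add: pos_le_divide_eq mult.commute algebra_simps)
      then show "- h ((1 - t) *\<^sub>R y + t *\<^sub>R z) \<le> (1 - t) * - h y + t * - h z"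
        using t by (simp add: pos_le_divide_eq algebra_simps)
    qed (use X in auto)
    show "1 \<le> h y" if "y \<in> K" for y
      using fh[OF DK[OF that], of y] minkowski_zero[OF V3] by (simp add: f_def)
    show "0 \<le> h y" if "y \<in> X" for y
      using fh[OF DX[OF that], of y] minkowski_zero[OF V3] by (simp add: f_def)
    show "h y \<le> 1" for y using f_le by (rule h_le)
    show "h x \<le> e"
    proof (rule h_le)
      fix w assume w: "w \<in> D"
      obtain l c where lc: "w = (l, c)" by fastforce
      from DE[OF w[unfolded lc]] obtain k z
        where kz: "k \<in> K" "z \<in> X" "0 \<le> l" "l \<le> 1" "c = l *\<^sub>R k + (1 - l) *\<^sub>R z" by auto
      \<comment> \<open>A large weight puts \<open>c\<close> in \<open>C\<close>, where the penalty
        of at least 1 cancels the weight; otherwise the weight itself is below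
        \<open>e\<close>.\<close>
      show "f x w \<le> e"
      proof (cases "min e 1 \<le> l")
        case True
        then have "c \<in> C" using kz by (force simp: C_def cc_def)
        then have "x - c \<notin> V" using V by (auto simp: U_def)
        then show ?thesis
          using minkowski_ge_1[OF V3, of "x - c"] kz e by (simp add: f_def lc)
      next
        case False
        then show ?thesis
          using minkowski_nonneg[OF V3, of "x - c"] kz by (simp add: f_def lc)
      qed
    qed
  qed
qed

section \<open>Measures above a Dirac measure in the Choquet order\<close>

lemma M_1D:
  assumes "\<mu> \<in> M_1 X" shows "space \<mu> = X" "sets (restrict_space borel X) \<subseteq> sets \<mu>"
    "emeasure \<mu> X = 1" "complete_measure \<mu>" "prob_space \<mu>"
    "\<And>B. B \<in> sets \<mu> \<Longrightarrow> emeasure \<mu> B = (SUP K\<in>{K. compact K \<and> K \<subseteq> B}. emeasure \<mu> K)"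
  using assms by (auto simp: M_1_def intro!: prob_spaceI)

text \<open>Otherwise inner regularity gives a compact set of positive mass missing
  \<open>x\<close>. A finite cover by gauge balls yields a compact convex piece of positive mass
  missing \<open>x\<close>, and a concave function separating it from \<open>x\<close> violates
  \<open>le\<close>.\<close>

lemma choquet_le_dirac_null:
  fixes X :: "'a::hausdorff_lcs set"
  assumes X: "compact X" "convex X" and x: "x extreme_point_of X" and \<nu>: "\<nu> \<in> M_1 X"
    and le: "\<And>f. convex_on X f \<Longrightarrow> continuous_on X f \<Longrightarrow> f x \<le> (\<integral>y. f y \<partial>\<nu>)"
  shows "X - {x} \<in> null_sets \<nu>"
proof (rule ccontr)
  note \<nu>_props = M_1D[OF \<nu>]
  interpret prob_space \<nu> by fact
  have borel: "A \<inter> X \<in> sets \<nu>" if "A \<in> sets borel" for A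
    using that \<nu>_props(2) by (auto simp: sets_restrict_space)
  have m: "X - {x} \<in> sets \<nu>" using borel[of "- {x}"] by (simp add: Diff_eq Int_commute)
  assume "X - {x} \<notin> null_sets \<nu>"
  then have "0 < emeasure \<nu> (X - {x})" using m by (simp add: null_sets_def zero_less_iff_neq_zero)
  then obtain K0 where K0: "compact K0" "K0 \<subseteq> X - {x}" "0 < emeasure \<nu> K0"
    unfolding \<nu>_props(6)[OF m] by (auto simp: less_SUP_iff)
  have "\<exists>V. open V \<and> 0 \<in> V \<and> convex V \<and> x - y \<notin> V" if "y \<in> K0" for y
  proof -
    have "open (- {x - y})" "0 \<in> - {x - y}" using that K0 by auto
    then obtain V where "open V" "0 \<in> V" "convex V" "V \<subseteq> - {x - y}" by (rule open_convex_subset)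
    then show ?thesis by (intro exI[of _ V]) auto
  qed
  then obtain V where V: "\<And>y. y \<in> K0 \<Longrightarrow> open (V y) \<and> 0 \<in> V y \<and> convex (V y) \<and> x - y \<notin> V y"
    by metis
  \<comment> \<open>The radius 1/2 lies below the gauge of \<open>x - y\<close>, which is at least
    1, so \<open>P y\<close> misses \<open>x\<close>. The open balls give the finite cover, the
    closed ones compact convex pieces of \<open>X\<close>.\<close>
  define O' where "O' y = {z. minkowski (V y) (z - y) < 1/2}" for y
  define P where "P y = X \<inter> {z. minkowski (V y) (z - y) \<le> 1/2}" for y
  have cont: "continuous_on S (\<lambda>z. minkowski (V y) (z - y))" if "y \<in> K0" for y S
    using V[OF that] by (intro continuous_on_minkowski) auto
  have "open (O' y)" if "y \<in> K0" for y
    unfolding O'_def using cont[OF that] by (intro open_Collect_less continuous_intros) auto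
  moreover have "K0 \<subseteq> (\<Union>y\<in>K0. O' y)"
    using V by (auto simp: O'_def minkowski_zero)
  ultimately obtain I where I: "I \<subseteq> K0" "finite I" "K0 \<subseteq> (\<Union>y\<in>I. O' y)"
    using compactE_image[OF K0(1), of K0 O'] by metis
  have Pc: "compact (P y)" if "y \<in> K0" for y
    unfolding P_def using cont[OF that] X
    by (intro compact_Int_closed closed_Collect_le continuous_intros) auto
  have Pm: "P y \<in> sets \<nu>" if "y \<in> K0" for y
    using borel[of "P y"] compact_imp_closed[OF Pc[OF that]] by (simp add: P_def Int_commute Int_left_commute)
  have "\<exists>y\<in>I. 0 < emeasure \<nu> (P y)"
  proof (rule ccontr)
    assume "\<not> ?thesis"
    then have "emeasure \<nu> (\<Union>y\<in>I. P y) \<le> 0"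
      using emeasure_subadditive_finite[of I P \<nu>] I Pm by (auto simp: image_subset_iff)
    moreover have "K0 \<subseteq> (\<Union>y\<in>I. P y)"
    proof
      fix z assume "z \<in> K0"
      then obtain y where "y \<in> I" "z \<in> O' y" using I by auto
      moreover have "z \<in> X" using \<open>z \<in> K0\<close> K0 by auto
      ultimately show "z \<in> (\<Union>y\<in>I. P y)" by (auto simp: O'_def P_def intro!: bexI[of _ y])
    qed
    then have "emeasure \<nu> K0 \<le> emeasure \<nu> (\<Union>y\<in>I. P y)"
      using I Pm by (intro emeasure_mono sets.finite_UN) auto
    ultimately show False using K0 by simp
  qed
  then obtain y where y: "y \<in> K0" "0 < emeasure \<nu> (P y)" using I by auto
  note Vy = V[OF y(1)]
  have "convex {z. minkowski (V y) (z - y) \<le> 1/2}" using Vy by (intro convex_minkowski_ball) auto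
  then have "convex (P y)" unfolding P_def using X by (intro convex_Int)
  have "P y \<noteq> {}" using y by auto
  have "1 \<le> minkowski (V y) (x - y)" using Vy by (intro minkowski_ge_1) auto
  then have "x \<notin> P y" by (auto simp: P_def)
  \<comment> \<open>The separation is applied with \<open>r / 2\<close>: testing \<open>le\<close>
    with the convex function \<open>- h\<close> puts the mass \<open>r\<close> below
    \<open>h x\<close>, which is at most \<open>r / 2\<close>.\<close>
  define r where "r = measure \<nu> (P y)"
  have "0 < r" using y by (simp add: r_def emeasure_eq_measure)
  obtain h where h: "continuous_on X h" "convex_on X (\<lambda>y. - h y)"
    "\<And>z. z \<in> P y \<Longrightarrow> 1 \<le> h z" "\<And>z. z \<in> X \<Longrightarrow> 0 \<le> h z" "\<And>z. h z \<le> 1" "h x \<le> r / 2"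
    using concave_separation[OF Pc[OF y(1)] \<open>convex (P y)\<close> \<open>P y \<noteq> {}\<close> _ X x \<open>x \<notin> P y\<close>, of "r / 2"]
      \<open>0 < r\<close> by (auto simp: P_def)
  have "h \<in> borel_measurable (restrict_space borel X)"
    using h(1) by (rule borel_measurable_continuous_on_restrict)
  then have "h \<in> borel_measurable \<nu>"
    using \<nu>_props by (auto simp: measurable_def space_restrict_space)
  then have int: "integrable \<nu> h"
    using h \<nu>_props(1) by (intro integrable_const_bound[of _ 1]) auto
  have "r = (\<integral>z. indicator (P y) z \<partial>\<nu>)"
    using Pm[OF y(1)] \<nu>_props(1) by (simp add: r_def Int_absorb2 P_def)
  also have "\<dots> \<le> (\<integral>z. h z \<partial>\<nu>)"
    using Pm[OF y(1)] int h \<nu>_props(1)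
    by (intro integral_mono) (auto simp: emeasure_eq_measure integrable_indicator_iff split: split_indicator)
  also have "\<dots> \<le> h x"
    using le[of "\<lambda>y. - h y"] h by (simp add: continuous_on_minus)
  finally show False using h \<open>0 < r\<close> by simp
qed

text \<open>All subsets of \<open>X\<close> are measurable for this Dirac measure, so it is
  complete. A measure above it is null off \<open>x\<close>; its own completeness makes every subset
  of \<open>X - {x}\<close> measurable, so both the sigma-algebra and the values agree.\<close>

lemma maximal_measure_dirac:
  fixes X :: "'a::hausdorff_lcs set"
  assumes X: "compact X" "convex X" and x: "x extreme_point_of X"
  shows "maximal_measure X (return (count_space X) x)"
proof -
  let ?D = "return (count_space X) x"
  have "x \<in> X" using x by (simp add: extreme_point_of_def)
  have "emeasure ?D B = (SUP K\<in>{K. compact K \<and> K \<subseteq> B}. emeasure ?D K)" if "B \<subseteq> X" for B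
  proof (intro antisym SUP_least)
    show "emeasure ?D B \<le> (SUP K\<in>{K. compact K \<and> K \<subseteq> B}. emeasure ?D K)"
    proof (cases "x \<in> B")
      case True
      then show ?thesis using that \<open>x \<in> X\<close> by (intro SUP_upper2[of "{x}"]) auto
    qed (use that in simp)
  qed (use that in \<open>auto intro: emeasure_mono\<close>)
  then have D: "?D \<in> M_1 X"
    using \<open>x \<in> X\<close> by (auto simp: M_1_def complete_measure_def sets_restrict_space null_sets_def)
  have "\<nu> = ?D" if \<nu>: "\<nu> \<in> M_1 X" and le: "choquet_le X ?D \<nu>" for \<nu>
  proof -
    note \<nu>_props = M_1D[OF \<nu>]
    interpret complete_measure \<nu> by fact
    have "f x \<le> (\<integral>y. f y \<partial>\<nu>)" if "convex_on X f" "continuous_on X f" for f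
      using le that \<open>x \<in> X\<close> by (simp add: choquet_le_def integral_return)
    then have N: "X - {x} \<in> null_sets \<nu>"
      using choquet_le_dirac_null[OF X x \<nu>] by blast
    then have sub: "A \<in> null_sets \<nu>" if "A \<subseteq> X - {x}" for A
      using that complete by (meson null_sets_subset)
    have "X - (X - {x}) \<in> sets \<nu>" using N \<nu>_props(1) by (metis null_setsD2 sets.compl_sets)
    then have sx: "{x} \<in> sets \<nu>" using \<open>x \<in> X\<close> by (simp add: Diff_Diff_Int)
    have A: "A \<in> sets \<nu> \<and> emeasure \<nu> A = indicator A x" if "A \<subseteq> X" for A
    proof -
      have n: "A - {x} \<in> null_sets \<nu>" using that by (intro sub) auto
      show ?thesis
      proof (cases "x \<in> A")
        case False
        then have "A - {x} = A" by simp
        then show ?thesis using n False by (auto simp: null_sets_def)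
      next
        case True
        then have eq: "A = {x} \<union> (A - {x})" "X = {x} \<union> (X - {x})" using \<open>x \<in> X\<close> by auto
        have "emeasure \<nu> A = emeasure \<nu> {x}" "emeasure \<nu> X = emeasure \<nu> {x}"
          using emeasure_Un_null_set[OF sx n] emeasure_Un_null_set[OF sx N] eq by metis+
        moreover have "A \<in> sets \<nu>" using eq sx n by (metis null_setsD2 sets.Un)
        ultimately show ?thesis using \<nu>_props(3) True by simp
      qed
    qed
    have "sets \<nu> = Pow X"
      using A sets.sets_into_space[of _ \<nu>] \<nu>_props(1) by auto
    then show ?thesis using A by (intro measure_eqI) auto
  qed
  with D show ?thesis by (simp add: maximal_measure_def)
qed

section \<open>Intermediate function spaces determined by extreme points\<close>

lemma ext_pts_subset: "ext_pts X \<subseteq> X"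
  by (auto simp: ext_pts_def extreme_point_of_def)

locale determined_space =
  fixes X :: "'a::{real_vector, topological_space} set" and H :: "('a \<Rightarrow> real) set"
  assumes space: "intermediate_function_space X H"
    and H_eq: "H = up H \<inter> down H"
    and determined: "determined_by_extreme_points X (up H)"
begin

text \<open>Constants are cut off outside \<open>X\<close> to match the convention that functions on
  \<open>X\<close> vanish elsewhere.\<close>

definition const :: "real \<Rightarrow> 'a \<Rightarrow> real" where
  "const c x = (if x \<in> X then c else 0)"

lemma H_A_b: "u \<in> H \<Longrightarrow> u \<in> A_b X"
  using space by (auto simp: intermediate_function_space_def)

lemma H_add: "u \<in> H \<Longrightarrow> v \<in> H \<Longrightarrow> (\<lambda>x. u x + v x) \<in> H"
  using space by (auto simp: intermediate_function_space_def)

lemma H_scale: "u \<in> H \<Longrightarrow> (\<lambda>x. c * u x) \<in> H"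
  using space by (auto simp: intermediate_function_space_def)

lemma H_diff: "u \<in> H \<Longrightarrow> v \<in> H \<Longrightarrow> (\<lambda>x. u x - v x) \<in> H"
  using H_add[OF _ H_scale[of v "- 1"]] by simp

lemma H_bounded:
  assumes "u \<in> H" obtains C where "0 \<le> C" "\<And>x. \<bar>u x\<bar> \<le> C"
proof -
  obtain C where C: "\<And>x. x \<in> X \<Longrightarrow> \<bar>u x\<bar> \<le> C"
    using H_A_b[OF assms] by (auto simp: A_b_def bounded_iff)
  \<comment> \<open>For empty \<open>X\<close> the constant \<open>C\<close> may be
    negative.\<close>
  have "\<bar>u x\<bar> \<le> max C 0" for x
    using C[of x] H_A_b[OF assms] by (cases "x \<in> X") (auto simp: A_b_def)
  then show thesis by (intro that[of "max C 0"]) auto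
qed

lemma H_up: "u \<in> H \<Longrightarrow> u \<in> up H"
  using H_eq by blast

lemma up_outside: "u \<in> up H \<Longrightarrow> x \<notin> X \<Longrightarrow> u x = 0"
proof -
  assume "u \<in> up H" "x \<notin> X"
  then obtain p where p: "\<And>n. p n \<in> H" "(\<lambda>n. p n x) \<longlonglongrightarrow> u x" by (auto simp: up_def)
  have "p n x = 0" for n using H_A_b[OF p(1)[of n]] \<open>x \<notin> X\<close> by (simp add: A_b_def)
  then show "u x = 0" using p(2) by (simp add: LIMSEQ_const_iff)
qed

end

locale determined_convex_space = determined_space +
  assumes convex: "convex X"
begin

lemma H_const: "const c \<in> H"
proof -
  have "affine_function_on X (const c)"
    using convex by (auto simp: affine_function_on_def const_def convex_alt algebra_simps)
  moreover have "continuous_on X (const c)"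
    by (rule continuous_on_eq[of _ "\<lambda>_. c"]) (auto simp: const_def)
  ultimately show ?thesis
    using space by (auto simp: intermediate_function_space_def A_c_def const_def)
qed

text \<open>If there were no extreme points, all constants would have to lie below the junk value
  \<open>Sup {}\<close>.\<close>

lemma ext_pts_nonempty:
  assumes "X \<noteq> {}" shows "ext_pts X \<noteq> {}"
proof
  assume empty: "ext_pts X = {}"
  obtain x where "x \<in> X" using assms by blast
  then have "const (Sup {} + 1) x \<le> Sup (const (Sup {} + 1) ` ext_pts X)"
    using determined H_up[OF H_const] by (auto simp: determined_by_extreme_points_def)
  then show False using \<open>x \<in> X\<close> empty by (simp add: const_def)
qed

section \<open>Comparison through values at extreme points\<close>

text \<open>A minimum principle. It covers \<open>up H\<close> and not only \<open>H\<close> because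
  it is applied to a monotone limit whose membership in \<open>H\<close> is still unknown.\<close>

lemma up_nonneg:
  assumes u: "u \<in> up H" and ext: "\<And>x. x \<in> ext_pts X \<Longrightarrow> 0 \<le> u x"
  shows "0 \<le> u x"
proof (cases "x \<in> X")
  case True
  then have "0 \<le> Inf (u ` ext_pts X)"
    using ext ext_pts_nonempty by (intro cINF_greatest) auto
  also have "\<dots> \<le> u x"
    using determined u True by (auto simp: determined_by_extreme_points_def)
  finally show ?thesis .
qed (use up_outside[OF u] in simp)

lemma up_nonpos:
  assumes u: "u \<in> up H" and ext: "\<And>x. x \<in> ext_pts X \<Longrightarrow> u x \<le> 0"
  shows "u x \<le> 0"
proof (cases "x \<in> X")
  case True
  then have "u x \<le> Sup (u ` ext_pts X)"
    using determined u by (auto simp: determined_by_extreme_points_def)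
  also have "\<dots> \<le> 0"
    using ext ext_pts_nonempty True by (intro cSUP_least) auto
  finally show ?thesis .
qed (use up_outside[OF u] in simp)

lemma H_le:
  assumes "u \<in> H" "v \<in> H" "\<And>x. x \<in> ext_pts X \<Longrightarrow> u x \<le> v x"
  shows "u x \<le> v x"
  using up_nonneg[OF H_up[OF H_diff[OF assms(2,1)]], of x] assms(3) by simp

lemma H_abs_le:
  assumes "u \<in> H" "0 \<le> C" "\<And>x. x \<in> ext_pts X \<Longrightarrow> \<bar>u x\<bar> \<le> C"
  shows "\<bar>u x\<bar> \<le> C"
proof -
  have *: "- C \<le> u y \<and> u y \<le> C \<and> y \<in> X" if "y \<in> ext_pts X" for y
    using assms(3)[OF that] ext_pts_subset that by auto
  have "u x \<le> const C x"
    using assms(1) H_const by (rule H_le) (use * in \<open>auto simp: const_def\<close>)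
  moreover have "const (- C) x \<le> u x"
    using H_const assms(1) by (rule H_le) (use * in \<open>auto simp: const_def\<close>)
  ultimately show ?thesis using \<open>0 \<le> C\<close> by (auto simp: const_def split: if_splits)
qed

section \<open>Limits in \<open>H\<close> controlled at extreme points\<close>

text \<open>By \<open>H_abs_le\<close>, closeness to \<open>g\<close> at extreme points makes
  \<open>u\<close> uniformly Cauchy everywhere; its limit is bounded and affine, so norm-closedness
  of \<open>H\<close> applies.\<close>

lemma H_uniform_closed:
  assumes u: "\<And>n. u n \<in> H" and e: "e \<longlonglongrightarrow> 0" "\<And>n. 0 \<le> e n"
    and ext: "\<And>n x. x \<in> ext_pts X \<Longrightarrow> \<bar>u n x - g x\<bar> \<le> e n"
  obtains f where "f \<in> H" "\<And>x. x \<in> ext_pts X \<Longrightarrow> f x = g x" "\<And>x. (\<lambda>n. u n x) \<longlonglongrightarrow> f x"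
proof -
  have *: "\<bar>u n x - u m x\<bar> \<le> e n + e m" for n m x
    using H_diff[OF u u]
  proof (rule H_abs_le[of "\<lambda>x. u n x - u m x"])
    show "\<bar>u n y - u m y\<bar> \<le> e n + e m" if "y \<in> ext_pts X" for y
      using ext[OF that, of n] ext[OF that, of m] by linarith
  qed (simp add: e)
  have "Cauchy (\<lambda>n. u n x)" for x
  proof (rule metric_CauchyI)
    fix d :: real assume "0 < d"
    then have "\<forall>\<^sub>F n in sequentially. e n < d / 2"
      using e(1) by (intro order_tendstoD(2)) auto
    then obtain N where N: "\<And>n. n \<ge> N \<Longrightarrow> e n < d / 2"
      by (auto simp: eventually_sequentially)
    show "\<exists>N. \<forall>m\<ge>N. \<forall>n\<ge>N. dist (u m x) (u n x) < d"
    proof (intro exI allI impI)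
      fix m n assume "m \<ge> N" "n \<ge> N"
      then show "dist (u m x) (u n x) < d"
        using N[of m] N[of n] *[of m x n] by (simp add: dist_real_def)
    qed
  qed
  then have "convergent (\<lambda>n. u n x)" for x by (rule Cauchy_convergent)
  then obtain f where f: "\<And>x. (\<lambda>n. u n x) \<longlonglongrightarrow> f x"
    unfolding convergent_def by metis
  have close: "\<bar>u n x - f x\<bar> \<le> e n" for n x
  proof (rule LIMSEQ_le[of "\<lambda>m. \<bar>u n x - u m x\<bar>" _ "\<lambda>m. e n + e m"])
    show "(\<lambda>m. \<bar>u n x - u m x\<bar>) \<longlonglongrightarrow> \<bar>u n x - f x\<bar>"
      by (intro tendsto_intros f)
    show "(\<lambda>m. e n + e m) \<longlonglongrightarrow> e n"
      using tendsto_add[OF tendsto_const e(1), of "e n"] by simp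
  qed (use * in auto)
  have "f \<in> A_b X"
  proof -
    have "f x = 0" if "x \<notin> X" for x
      using up_outside[OF H_up[OF u] that] f[of x] by (simp add: LIMSEQ_const_iff)
    moreover have "f ((1 - t) *\<^sub>R x + t *\<^sub>R y) = (1 - t) * f x + t * f y"
      if "x \<in> X" "y \<in> X" "t \<in> {0..1}" for x y t
    proof (rule LIMSEQ_unique[OF f])
      have "u n ((1 - t) *\<^sub>R x + t *\<^sub>R y) = (1 - t) * u n x + t * u n y" for n
        using H_A_b[OF u[of n]] that unfolding A_b_def affine_function_on_def by blast
      then show "(\<lambda>n. u n ((1 - t) *\<^sub>R x + t *\<^sub>R y)) \<longlonglongrightarrow> (1 - t) * f x + t * f y"
        using tendsto_add[OF tendsto_mult_left[OF f[of x], of "1 - t"] tendsto_mult_left[OF f[of y], of t]]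
        by simp
    qed
    moreover have "bounded (f ` X)"
    proof -
      obtain C where C: "\<And>x. \<bar>u 0 x\<bar> \<le> C" using H_bounded[OF u[of 0]] by blast
      have "\<bar>f x\<bar> \<le> C + e 0" for x using C[of x] close[of 0 x] by linarith
      then show ?thesis by (auto simp: bounded_iff)
    qed
    ultimately show ?thesis by (auto simp: A_b_def affine_function_on_def)
  qed
  moreover have "uniform_limit X u f sequentially"
  proof (rule uniform_limitI)
    fix d :: real assume "0 < d"
    with e(1) have "\<forall>\<^sub>F n in sequentially. e n < d" by (rule order_tendstoD(2))
    then show "\<forall>\<^sub>F n in sequentially. \<forall>x\<in>X. dist (u n x) (f x) < d"
      by eventually_elim (use close in \<open>auto simp: dist_real_def intro: le_less_trans\<close>)
  qed
  ultimately have "f \<in> H"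
    using space u unfolding intermediate_function_space_def by blast
  moreover have "f x = g x" if "x \<in> ext_pts X" for x
  proof (rule LIMSEQ_unique[OF f])
    have "\<forall>\<^sub>F n in sequentially. norm (u n x - g x) \<le> e n" using ext[OF that] by simp
    then have "(\<lambda>n. u n x - g x) \<longlonglongrightarrow> 0" using e(1) by (rule Lim_null_comparison)
    then show "(\<lambda>n. u n x) \<longlonglongrightarrow> g x" by (rule LIM_zero_cancel)
  qed
  ultimately show thesis using f that by blast
qed

text \<open>The difference of the two monotone limits lies in \<open>up H\<close> and vanishes at the extreme
  points, so the limits coincide on all of \<open>X\<close>.\<close>

lemma H_squeeze:
  assumes u: "\<And>n. u n \<in> H" and v: "\<And>n. v n \<in> H"
    and inc: "\<And>n x. x \<in> ext_pts X \<Longrightarrow> u n x \<le> u (Suc n) x"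
    and dec: "\<And>n x. x \<in> ext_pts X \<Longrightarrow> v (Suc n) x \<le> v n x"
    and lim: "\<And>x. x \<in> ext_pts X \<Longrightarrow> (\<lambda>n. u n x) \<longlonglongrightarrow> g x"
      "\<And>x. x \<in> ext_pts X \<Longrightarrow> (\<lambda>n. v n x) \<longlonglongrightarrow> g x"
  obtains f where "f \<in> H" "\<And>x. x \<in> ext_pts X \<Longrightarrow> f x = g x" "\<And>x. (\<lambda>n. u n x) \<longlonglongrightarrow> f x"
proof -
  have iu: "incseq (\<lambda>n. u n x)" for x
    by (rule incseq_SucI) (rule H_le[OF u u inc])
  have dv: "decseq (\<lambda>n. v n x)" for x
    by (rule decseq_SucI) (rule H_le[OF v v dec])
  \<comment> \<open>At extreme points the common limit \<open>g\<close> separates the two sequences,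
    and the order carries over to all points.\<close>
  have uv: "u n x \<le> v n x" for n x
  proof (rule H_le[OF u v])
    fix y assume y: "y \<in> ext_pts X"
    show "u n y \<le> v n y"
      using incseq_le[OF iu lim(1)[OF y], of n] decseq_ge[OF dv lim(2)[OF y], of n] by linarith
  qed
  obtain C1 where C1: "\<And>x. \<bar>u 0 x\<bar> \<le> C1" using H_bounded[OF u[of 0]] by blast
  obtain C2 where C2: "\<And>x. \<bar>v 0 x\<bar> \<le> C2" using H_bounded[OF v[of 0]] by blast
  have bounds: "- C1 \<le> u n x" "v n x \<le> C2" for n x
    using incseqD[OF iu[of x], of 0 n] decseqD[OF dv[of x], of 0 n] C1[of x] C2[of x] by auto
  have b: "\<bar>u n x\<bar> \<le> C1 + C2" "\<bar>v n x\<bar> \<le> C1 + C2" "\<bar>u n x - v n x\<bar> \<le> (C1 + C2) + (C1 + C2)" for n x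
    using bounds[of n x] uv[of n x] C1[of x] C2[of x] by linarith+
  have "convergent (\<lambda>n. u n x)" for x
    using b iu by (intro Bseq_monoseq_convergent) (auto simp: monoseq_iff intro!: BseqI')
  moreover have "convergent (\<lambda>n. v n x)" for x
    using b dv by (intro Bseq_monoseq_convergent) (auto simp: monoseq_iff intro!: BseqI')
  ultimately obtain f f' where f: "\<And>x. (\<lambda>n. u n x) \<longlonglongrightarrow> f x" and f': "\<And>x. (\<lambda>n. v n x) \<longlonglongrightarrow> f' x"
    unfolding convergent_def by metis
  have fg: "f x = g x" "f' x = g x" if "x \<in> ext_pts X" for x
    using LIMSEQ_unique[OF f lim(1)[OF that]] LIMSEQ_unique[OF f' lim(2)[OF that]] by auto
  have w: "(\<lambda>x. f x - f' x) \<in> up H"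
    unfolding up_def
  proof (intro CollectI exI[of _ "\<lambda>n x. u n x - v n x"] conjI allI)
    show "incseq (\<lambda>n x. u n x - v n x)"
      unfolding incseq_def le_fun_def
      by (intro allI impI diff_mono incseqD[OF iu] decseqD[OF dv])
  qed (use u v b f f' in \<open>auto intro: H_diff tendsto_diff\<close>)
  have eq: "f x = f' x" for x
    using up_nonneg[OF w, of x] up_nonpos[OF w, of x] fg by simp
  have "f \<in> up H"
    unfolding up_def
    by (intro CollectI exI[of _ u]) (use u b f iu in \<open>auto simp: incseq_def le_fun_def\<close>)
  moreover have "f \<in> down H"
    unfolding down_def
  proof (intro CollectI exI[of _ v] conjI allI)
    show "decseq v"
      by (intro decseq_SucI le_funI decseq_SucD[OF dv])
  qed (use v b f' eq in auto)
  ultimately have "f \<in> H" using H_eq by blast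
  then show thesis using fg f that by blast
qed

end

section \<open>Multipliers along a filter\<close>

text \<open>Multipliers and strong multipliers only differ in the filter of sets on which the products
  have to agree: the sets containing all extreme points, or the sets of full measure for every
  maximal measure.\<close>

locale multiplier_filter = determined_convex_space +
  fixes F :: "'a filter"
  assumes F_ext: "\<And>P x. eventually P F \<Longrightarrow> x \<in> ext_pts X \<Longrightarrow> P x"
    and F_countable: "\<And>P. (\<And>n::nat. eventually (P n) F) \<Longrightarrow> eventually (\<lambda>x. \<forall>n. P n x) F"
begin

definition Mult :: "('a \<Rightarrow> real) set" where
  "Mult = {u \<in> H. \<forall>a\<in>H. \<exists>b\<in>H. eventually (\<lambda>x. b x = u x * a x) F}"

abbreviation extendable :: "('a \<Rightarrow> real) \<Rightarrow> bool" where
  "extendable \<equiv> extends_to (ext_pts X) Mult"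

lemma Mult_H: "u \<in> Mult \<Longrightarrow> u \<in> H"
  by (simp add: Mult_def)

lemma Mult_product:
  assumes "u \<in> Mult" "a \<in> H"
  obtains b where "b \<in> H" "eventually (\<lambda>x. b x = u x * a x) F"
  using assms by (auto simp: Mult_def)

section \<open>Two-sided monotone limits of multipliers\<close>

text \<open>\<open>H_squeeze\<close> is used twice: for the functions themselves and for their
  products with a given element of \<open>H\<close>.\<close>

lemma Mult_squeeze:
  assumes u: "\<And>n. u n \<in> Mult" and v: "\<And>n. v n \<in> Mult"
    and inc: "\<And>n x. x \<in> ext_pts X \<Longrightarrow> u n x \<le> u (Suc n) x"
    and dec: "\<And>n x. x \<in> ext_pts X \<Longrightarrow> v (Suc n) x \<le> v n x"
    and lim: "\<And>x. x \<in> ext_pts X \<Longrightarrow> (\<lambda>n. u n x) \<longlonglongrightarrow> g x"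
      "\<And>x. x \<in> ext_pts X \<Longrightarrow> (\<lambda>n. v n x) \<longlonglongrightarrow> g x"
  obtains f where "f \<in> Mult" "\<And>x. x \<in> ext_pts X \<Longrightarrow> f x = g x" "\<And>x. (\<lambda>n. u n x) \<longlonglongrightarrow> f x"
proof -
  obtain f where f: "f \<in> H" "\<And>x. x \<in> ext_pts X \<Longrightarrow> f x = g x" "\<And>x. (\<lambda>n. u n x) \<longlonglongrightarrow> f x"
    using H_squeeze[OF Mult_H[OF u] Mult_H[OF v] inc dec lim] by blast
  have "\<exists>b\<in>H. eventually (\<lambda>x. b x = f x * a x) F" if a: "a \<in> H" for a
  proof -
    obtain C where C: "0 \<le> C" "\<And>x. \<bar>a x\<bar> \<le> C" using H_bounded[OF a] by blast
    \<comment> \<open>Multiplication preserves monotonicity only for nonnegative factors, so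
      \<open>a\<close> is shifted by a bound.\<close>
    define a' where "a' x = a x + const C x" for x
    have a': "a' \<in> H" unfolding a'_def by (intro H_add a H_const)
    have a'0: "0 \<le> a' x" if "x \<in> ext_pts X" for x
      using C(2)[of x] that ext_pts_subset by (force simp: a'_def const_def)
    have "\<exists>p. p \<in> H \<and> eventually (\<lambda>x. p x = u n x * a' x) F" for n
      using Mult_product[OF u a'] by blast
    then obtain p where p: "\<And>n. p n \<in> H" "\<And>n. eventually (\<lambda>x. p n x = u n x * a' x) F"
      by metis
    have "\<exists>q. q \<in> H \<and> eventually (\<lambda>x. q x = v n x * a' x) F" for n
      using Mult_product[OF v a'] by blast
    then obtain q where q: "\<And>n. q n \<in> H" "\<And>n. eventually (\<lambda>x. q n x = v n x * a' x) F"
      by metis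
    note pq = F_ext[OF p(2)] F_ext[OF q(2)]
    obtain b where b: "b \<in> H" "\<And>x. (\<lambda>n. p n x) \<longlonglongrightarrow> b x"
    proof (rule H_squeeze[where g = "\<lambda>x. g x * a' x", OF p(1) q(1)])
      fix x assume x: "x \<in> ext_pts X"
      show "p n x \<le> p (Suc n) x" "q (Suc n) x \<le> q n x" for n
        using x by (auto simp: pq intro!: mult_right_mono inc dec a'0)
      show "(\<lambda>n. p n x) \<longlonglongrightarrow> g x * a' x" "(\<lambda>n. q n x) \<longlonglongrightarrow> g x * a' x"
        using x by (auto simp: pq intro!: tendsto_mult_right lim)
    qed blast
    \<comment> \<open>All product identities hold at once along \<open>F\<close>. Since
      \<open>p n\<close> and \<open>u n\<close> converge at every point, the identity passes to the
      limit beyond the extreme points.\<close>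
    have "eventually (\<lambda>x. \<forall>n. p n x = u n x * a' x) F"
      by (rule F_countable) (rule p(2))
    \<comment> \<open>Subtracting \<open>C * f\<close> undoes the shift; outside \<open>X\<close>,
      where the shift is 0, \<open>f\<close> vanishes.\<close>
    then have "eventually (\<lambda>x. b x - C * f x = f x * a x) F"
    proof eventually_elim
      case (elim x)
      have "(\<lambda>n. p n x) \<longlonglongrightarrow> f x * a' x"
        using tendsto_mult_right[OF f(3)[of x], of "a' x"] elim by simp
      then have "b x = f x * a' x" using b(2) LIMSEQ_unique by blast
      moreover have "f x = 0" if "x \<notin> X" using up_outside[OF H_up[OF f(1)] that] .
      ultimately show ?case by (auto simp: a'_def const_def algebra_simps)
    qed
    moreover have "(\<lambda>x. b x - C * f x) \<in> H" by (intro H_diff H_scale b f)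
    ultimately show ?thesis by (intro bexI[of _ "\<lambda>x. b x - C * f x"])
  qed
  then have "f \<in> Mult" using f by (simp add: Mult_def)
  then show thesis using f that by blast
qed

text \<open>Constant sequences give one inclusion. For the other, the multiplier found by
  \<open>Mult_squeeze\<close> is the pointwise limit everywhere, so it equals
  \<open>w\<close>.\<close>

lemma Mult_eq_up_down: "Mult = up Mult \<inter> down Mult"
proof (intro equalityI subsetI)
  fix u assume u: "u \<in> Mult"
  obtain C where "\<And>x. \<bar>u x\<bar> \<le> C" using H_bounded[OF Mult_H[OF u]] by blast
  then show "u \<in> up Mult \<inter> down Mult"
    using u unfolding up_def down_def
    by (intro IntI CollectI exI[of _ "\<lambda>_. u"]) (auto simp: incseq_def decseq_def)
next
  fix w assume "w \<in> up Mult \<inter> down Mult"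
  then obtain u v where u: "\<And>n. u n \<in> Mult" "incseq u" "\<And>x. (\<lambda>n. u n x) \<longlonglongrightarrow> w x"
    and v: "\<And>n. v n \<in> Mult" "decseq v" "\<And>x. (\<lambda>n. v n x) \<longlonglongrightarrow> w x"
    unfolding up_def down_def by blast
  have mono: "u n x \<le> u (Suc n) x" "v (Suc n) x \<le> v n x" for n x
    using incseq_SucD[OF u(2)] decseq_SucD[OF v(2)] by (auto simp: le_fun_def)
  obtain f where "f \<in> Mult" and f: "\<And>x. (\<lambda>n. u n x) \<longlonglongrightarrow> f x"
    by (rule Mult_squeeze[where g = w, OF u(1) v(1) mono u(3) v(3)]) blast
  moreover have "f = w" using LIMSEQ_unique[OF f u(3)] by (rule ext)
  ultimately show "w \<in> Mult" by simp
qed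

section \<open>The uniformly closed algebra of traces on the extreme points\<close>

lemma extendableE:
  assumes "extendable f"
  obtains u where "u \<in> Mult" "\<And>x. x \<in> ext_pts X \<Longrightarrow> u x = f x"
  using assms by (auto simp: extends_to_def)

lemma extendable_const: "extendable (\<lambda>_. c)"
proof -
  have "\<exists>b\<in>H. eventually (\<lambda>x. b x = const c x * a x) F" if "a \<in> H" for a
  proof (intro bexI[of _ "\<lambda>x. c * a x"] always_eventually allI H_scale that)
    show "c * a x = const c x * a x" for x
      using up_outside[OF H_up[OF that]] by (simp add: const_def)
  qed
  then have "const c \<in> Mult" using H_const by (auto simp: Mult_def)
  then show ?thesis
    unfolding extends_to_def by (rule bexI[rotated]) (use ext_pts_subset in \<open>auto simp: const_def\<close>)
qed

lemma extendable_add: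
  assumes "extendable f" "extendable g" shows "extendable (\<lambda>x. f x + g x)"
proof -
  obtain u v where u: "u \<in> Mult" "\<And>x. x \<in> ext_pts X \<Longrightarrow> u x = f x"
    and v: "v \<in> Mult" "\<And>x. x \<in> ext_pts X \<Longrightarrow> v x = g x"
    using assms by (auto elim!: extendableE)
  have "\<exists>b\<in>H. eventually (\<lambda>x. b x = (u x + v x) * a x) F" if a: "a \<in> H" for a
  proof -
    obtain p where p: "p \<in> H" "eventually (\<lambda>x. p x = u x * a x) F" using Mult_product[OF u(1) a] .
    obtain q where q: "q \<in> H" "eventually (\<lambda>x. q x = v x * a x) F" using Mult_product[OF v(1) a] .
    have "eventually (\<lambda>x. p x + q x = (u x + v x) * a x) F"
      using p(2) q(2) by eventually_elim (simp add: distrib_right)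
    then show ?thesis using H_add[OF p(1) q(1)] by (intro bexI[of _ "\<lambda>x. p x + q x"])
  qed
  then have "(\<lambda>x. u x + v x) \<in> Mult" using u v by (simp add: Mult_def H_add)
  then show ?thesis
    unfolding extends_to_def by (rule bexI[rotated]) (use u v in auto)
qed

text \<open>The element \<open>w\<close> of \<open>H\<close> representing the product is itself a
  multiplier: multiply by \<open>v\<close> first and by \<open>u\<close> afterwards.\<close>

lemma extendable_mult:
  assumes "extendable f" "extendable g" shows "extendable (\<lambda>x. f x * g x)"
proof -
  obtain u v where u: "u \<in> Mult" "\<And>x. x \<in> ext_pts X \<Longrightarrow> u x = f x"
    and v: "v \<in> Mult" "\<And>x. x \<in> ext_pts X \<Longrightarrow> v x = g x"
    using assms by (auto elim!: extendableE)
  obtain w where w: "w \<in> H" "eventually (\<lambda>x. w x = u x * v x) F"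
    using Mult_product[OF u(1) Mult_H[OF v(1)]] .
  have "\<exists>b\<in>H. eventually (\<lambda>x. b x = w x * a x) F" if a: "a \<in> H" for a
  proof -
    obtain p where p: "p \<in> H" "eventually (\<lambda>x. p x = v x * a x) F" using Mult_product[OF v(1) a] .
    obtain q where q: "q \<in> H" "eventually (\<lambda>x. q x = u x * p x) F" using Mult_product[OF u(1) p(1)] .
    have "eventually (\<lambda>x. q x = w x * a x) F"
      using p(2) q(2) w(2) by eventually_elim simp
    then show ?thesis using q(1) by blast
  qed
  then have "w \<in> Mult" using w by (simp add: Mult_def)
  then show ?thesis
    unfolding extends_to_def by (rule bexI[rotated]) (use u v F_ext[OF w(2)] in auto)
qed

lemma extendable_minus:
  assumes "extendable f" shows "extendable (\<lambda>x. - f x)"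
  using extendable_mult[OF extendable_const[of "- 1"] assms] by simp

lemma extendable_sum:
  assumes "\<And>i. i \<in> I \<Longrightarrow> extendable (f i)" shows "extendable (\<lambda>x. \<Sum>i\<in>I. f i x)"
  using assms
  by (induction I rule: infinite_finite_induct) (auto intro: extendable_const extendable_add)

text \<open>Each \<open>a\<close> in \<open>H\<close> is bounded, so the products with
  \<open>a\<close> also converge uniformly at extreme points and their limit stays in
  \<open>H\<close>.\<close>

lemma extendable_closed:
  assumes "\<And>e. 0 < e \<Longrightarrow> \<exists>h. extendable h \<and> (\<forall>x\<in>ext_pts X. \<bar>h x - g x\<bar> \<le> e)"
  shows "extendable g"
proof -
  define e where "e n = inverse (real (Suc n))" for n
  have e: "e \<longlonglongrightarrow> 0" "\<And>n. 0 \<le> e n"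
    unfolding e_def by (rule LIMSEQ_inverse_real_of_nat) simp
  have "\<exists>u. u \<in> Mult \<and> (\<forall>x\<in>ext_pts X. \<bar>u x - g x\<bar> \<le> e n)" for n
  proof -
    obtain h where "extendable h" "\<forall>x\<in>ext_pts X. \<bar>h x - g x\<bar> \<le> e n"
      using assms[of "e n"] by (auto simp: e_def)
    then show ?thesis by (metis extendableE)
  qed
  then obtain u where u: "\<And>n. u n \<in> Mult" "\<And>n x. x \<in> ext_pts X \<Longrightarrow> \<bar>u n x - g x\<bar> \<le> e n"
    by metis
  obtain f where f: "f \<in> H" "\<And>x. x \<in> ext_pts X \<Longrightarrow> f x = g x" "\<And>x. (\<lambda>n. u n x) \<longlonglongrightarrow> f x"
    using H_uniform_closed[OF Mult_H[OF u(1)] e u(2)] by blast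
  have "\<exists>b\<in>H. eventually (\<lambda>x. b x = f x * a x) F" if a: "a \<in> H" for a
  proof -
    obtain C where C: "0 \<le> C" "\<And>x. \<bar>a x\<bar> \<le> C" using H_bounded[OF a] by blast
    have "\<exists>p. p \<in> H \<and> eventually (\<lambda>x. p x = u n x * a x) F" for n
      using Mult_product[OF u(1) a] by blast
    then obtain p where p: "\<And>n. p n \<in> H" "\<And>n. eventually (\<lambda>x. p n x = u n x * a x) F"
      by metis
    have Ce: "(\<lambda>n. e n * C) \<longlonglongrightarrow> 0" using tendsto_mult_right[OF e(1), of C] by simp
    obtain b where b: "b \<in> H" "\<And>x. (\<lambda>n. p n x) \<longlonglongrightarrow> b x"
    proof (rule H_uniform_closed[where g = "\<lambda>x. g x * a x", OF p(1) Ce])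
      fix n x assume x: "x \<in> ext_pts X"
      have "\<bar>p n x - g x * a x\<bar> = \<bar>u n x - g x\<bar> * \<bar>a x\<bar>"
        using F_ext[OF p(2)[of n] x] by (simp add: abs_mult left_diff_distrib flip: abs_mult)
      also have "\<dots> \<le> e n * C" by (intro mult_mono u x C e) auto
      finally show "\<bar>p n x - g x * a x\<bar> \<le> e n * C" .
    qed (use C e in auto)
    have "eventually (\<lambda>x. \<forall>n. p n x = u n x * a x) F"
      by (rule F_countable) (rule p(2))
    then have "eventually (\<lambda>x. b x = f x * a x) F"
    proof eventually_elim
      case (elim x)
      have "(\<lambda>n. p n x) \<longlonglongrightarrow> f x * a x"
        using tendsto_mult_right[OF f(3)[of x], of "a x"] elim by simp
      then show ?case using b(2) LIMSEQ_unique by blast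
    qed
    then show ?thesis using b(1) by blast
  qed
  then have "f \<in> Mult" using f by (simp add: Mult_def)
  then show ?thesis using f unfolding extends_to_def by blast
qed

lemma extendable_bounded:
  assumes "extendable f" obtains C where "\<And>x. x \<in> ext_pts X \<Longrightarrow> \<bar>f x\<bar> \<le> C"
  using assms by (metis extendableE H_bounded Mult_H)

text \<open>Weierstrass approximation of \<open>\<phi>\<close> on an interval containing the values
  of \<open>f\<close>; polynomials in \<open>f\<close> stay in the algebra.\<close>

lemma extendable_compose:
  fixes \<phi> :: "real \<Rightarrow> real"
  assumes f: "extendable f" and \<phi>: "continuous_on UNIV \<phi>"
  shows "extendable (\<lambda>x. \<phi> (f x))"
proof (rule extendable_closed)
  fix e :: real assume "0 < e"
  obtain C where C: "\<And>x. x \<in> ext_pts X \<Longrightarrow> \<bar>f x\<bar> \<le> C" using extendable_bounded[OF f] by blast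
  obtain p where p: "real_polynomial_function p" "\<And>t. t \<in> {- C..C} \<Longrightarrow> \<bar>\<phi> t - p t\<bar> < e"
    using Stone_Weierstrass_real_polynomial_function[of "{- C..C}" \<phi> e] \<open>0 < e\<close>
      continuous_on_subset[OF \<phi>] by auto
  have "extendable (\<lambda>x. p (f x))"
    using p(1)
  proof induction
    case (linear p)
    then obtain c where "p = (\<lambda>x. x * c)" by (auto simp: real_bounded_linear)
    then show ?case using extendable_mult[OF f extendable_const] by simp
  qed (auto intro: extendable_const extendable_add extendable_mult)
  moreover have "\<bar>p (f x) - \<phi> (f x)\<bar> \<le> e" if "x \<in> ext_pts X" for x
    using p(2)[of "f x"] C[OF that] by (simp add: abs_le_iff abs_minus_commute less_imp_le)
  ultimately show "\<exists>h. extendable h \<and> (\<forall>x\<in>ext_pts X. \<bar>h x - \<phi> (f x)\<bar> \<le> e)" by blast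
qed

lemma extendable_squeeze:
  assumes u: "\<And>n. extendable (u n)" and v: "\<And>n. extendable (v n)"
    and inc: "\<And>n x. x \<in> ext_pts X \<Longrightarrow> u n x \<le> u (Suc n) x"
    and dec: "\<And>n x. x \<in> ext_pts X \<Longrightarrow> v (Suc n) x \<le> v n x"
    and lim: "\<And>x. x \<in> ext_pts X \<Longrightarrow> (\<lambda>n. u n x) \<longlonglongrightarrow> g x"
      "\<And>x. x \<in> ext_pts X \<Longrightarrow> (\<lambda>n. v n x) \<longlonglongrightarrow> g x"
  shows "extendable g"
proof -
  obtain p where p: "\<And>n. p n \<in> Mult" "\<And>n x. x \<in> ext_pts X \<Longrightarrow> p n x = u n x"
    using u unfolding extends_to_def by metis
  obtain q where q: "\<And>n. q n \<in> Mult" "\<And>n x. x \<in> ext_pts X \<Longrightarrow> q n x = v n x"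
    using v unfolding extends_to_def by metis
  obtain f where "f \<in> Mult" "\<And>x. x \<in> ext_pts X \<Longrightarrow> f x = g x"
    by (rule Mult_squeeze[where u = p and v = q and g = g, OF p(1) q(1)]) (simp_all add: p q inc dec lim)
  then show ?thesis by (auto simp: extends_to_def)
qed

section \<open>Extendable functions and measurability\<close>

text \<open>An open set is the positivity set of the distance to its complement, and composing this
  distance with \<open>f\<close> gives an extendable function.\<close>

lemma extendable_imp_measurable:
  assumes f: "extendable f"
  shows "family_measurable (ext_pts X) (positivity_sets X Mult) f"
  unfolding family_measurable_def
proof (intro allI impI)
  fix U :: "real set" assume "open U"
  \<comment> \<open>\<open>infdist\<close> to the empty set is 0, so \<open>UNIV\<close> needs its
    own case.\<close>
  define \<phi> where "\<phi> t = (if U = UNIV then 1 else infdist t (- U))" for t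
  have pos: "0 < \<phi> t \<longleftrightarrow> t \<in> U" for t
  proof (cases "U = UNIV")
    case False
    then have "- U \<noteq> {}" "closed (- U)" using \<open>open U\<close> by auto
    then have "t \<in> - U \<longleftrightarrow> infdist t (- U) = 0" by (rule in_closed_iff_infdist_zero[rotated])
    then show ?thesis using False infdist_nonneg[of t "- U"] by (auto simp: \<phi>_def less_le)
  qed (simp add: \<phi>_def)
  have "continuous_on UNIV \<phi>"
    unfolding \<phi>_def by (cases "U = UNIV") (auto intro!: continuous_intros)
  then obtain m where m: "m \<in> Mult" "\<And>x. x \<in> ext_pts X \<Longrightarrow> m x = \<phi> (f x)"
    using extendableE[OF extendable_compose[OF f]] by blast
  then have "{x \<in> ext_pts X. f x \<in> U} = {x \<in> X. m x > 0} \<inter> ext_pts X"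
    using pos ext_pts_subset by auto
  then show "{x \<in> ext_pts X. f x \<in> U} \<in> positivity_sets X Mult"
    using m by (auto simp: positivity_sets_def)
qed

text \<open>A Urysohn function for the disjoint complements of \<open>A\<close> and
  \<open>B\<close>.\<close>

lemma extendable_separation:
  assumes A: "A \<in> positivity_sets X Mult" and B: "B \<in> positivity_sets X Mult"
    and cover: "ext_pts X \<subseteq> A \<union> B"
  obtains v where "extendable v" "\<And>x. x \<in> ext_pts X \<Longrightarrow> 0 \<le> v x \<and> v x \<le> 1"
    "\<And>x. x \<in> ext_pts X \<Longrightarrow> x \<notin> A \<Longrightarrow> v x = 0" "\<And>x. x \<in> ext_pts X \<Longrightarrow> x \<notin> B \<Longrightarrow> v x = 1"
proof -
  have *: "\<exists>a. extendable a \<and> (\<forall>x. 0 \<le> a x) \<and> (\<forall>x\<in>ext_pts X. x \<in> S \<longleftrightarrow> 0 < a x)"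
    if S: "S \<in> positivity_sets X Mult" for S
  proof -
    obtain m where m: "m \<in> Mult" "S = {x\<in>X. m x > 0} \<inter> ext_pts X"
      using S by (auto simp: positivity_sets_def)
    have "extendable m" using m by (auto simp: extends_to_def)
    then have "extendable (\<lambda>x. max 0 (m x))"
      by (rule extendable_compose) (intro continuous_intros)
    then show ?thesis using m ext_pts_subset by (intro exI[of _ "\<lambda>x. max 0 (m x)"]) auto
  qed
  obtain a where a: "extendable a" "\<And>x. 0 \<le> a x" "\<And>x. x \<in> ext_pts X \<Longrightarrow> x \<in> A \<longleftrightarrow> 0 < a x"
    using *[OF A] by blast
  obtain b where b: "extendable b" "\<And>x. 0 \<le> b x" "\<And>x. x \<in> ext_pts X \<Longrightarrow> x \<in> B \<longleftrightarrow> 0 < b x"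
    using *[OF B] by blast
  \<comment> \<open>The cover makes the denominator of \<open>v\<close> positive at extreme
    points.\<close>
  have ab: "0 < a x + b x" if "x \<in> ext_pts X" for x
    using cover that a(2,3)[of x] b(2,3)[of x] by (smt (verit) UnE subsetD)
  define e where "e n = inverse (real (Suc n))" for n
  have e: "e \<longlonglongrightarrow> 0" "\<And>n. 0 < e n" "\<And>n. e (Suc n) \<le> e n"
    unfolding e_def by (rule LIMSEQ_inverse_real_of_nat) (auto simp: field_simps)
  have quot: "extendable (\<lambda>x. c x / (a x + b x + e n))" if c: "extendable c" for c n
  proof -
    \<comment> \<open>The \<open>max\<close> makes the function continuous on the whole line and
      changes nothing at the nonnegative values \<open>a x + b x\<close>.\<close>
    have "continuous_on UNIV (\<lambda>t. inverse (max t 0 + e n))"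
      using e(2)[of n] by (intro continuous_intros ballI) (simp add: add_nonneg_eq_0_iff less_le)
    then have "extendable (\<lambda>x. inverse (max (a x + b x) 0 + e n))"
      by (rule extendable_compose[OF extendable_add[OF a(1) b(1)]])
    then have "extendable (\<lambda>x. c x * inverse (max (a x + b x) 0 + e n))"
      by (rule extendable_mult[OF c])
    then show ?thesis using a(2) b(2) by (simp add: divide_inverse)
  qed
  define v where "v x = a x / (a x + b x)" for x
  have mono: "c / (a x + b x + e n) \<le> c / (a x + b x + e (Suc n))" if "0 \<le> c" for c n x
    using a(2)[of x] b(2)[of x] e(2)[of n] e(2)[of "Suc n"] e(3)[of n] that
    by (intro divide_left_mono) auto
  have lim: "(\<lambda>n. c / (a x + b x + e n)) \<longlonglongrightarrow> c / (a x + b x)" if "x \<in> ext_pts X" for c x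
  proof -
    have "(\<lambda>n. c / (a x + b x + e n)) \<longlonglongrightarrow> c / (a x + b x + 0)"
      using ab[OF that] by (intro tendsto_intros e) auto
    then show ?thesis by simp
  qed
  have "extendable v"
  proof (rule extendable_squeeze)
    show "extendable (\<lambda>x. a x / (a x + b x + e n))" for n by (rule quot[OF a(1)])
    show "extendable (\<lambda>x. 1 + - (b x / (a x + b x + e n)))" for n
      by (intro extendable_add extendable_minus extendable_const quot b)
    fix x assume x: "x \<in> ext_pts X"
    show "(\<lambda>n. a x / (a x + b x + e n)) \<longlonglongrightarrow> v x" unfolding v_def by (rule lim[OF x])
    have "v x = 1 + - (b x / (a x + b x))" using ab[OF x] by (simp add: v_def field_simps)
    then show "(\<lambda>n. 1 + - (b x / (a x + b x + e n))) \<longlonglongrightarrow> v x"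
      using lim[OF x, of "b x"] by (auto intro!: tendsto_intros)
  qed (use mono a b in auto)
  moreover have "0 \<le> v x \<and> v x \<le> 1" if "x \<in> ext_pts X" for x
    using a(2)[of x] b(2)[of x] ab[OF that] by (simp add: v_def)
  moreover have "v x = 0" if "x \<in> ext_pts X" "x \<notin> A" for x
    using a(2)[of x] a(3)[OF that(1)] that by (simp add: v_def)
  moreover have "v x = 1" if "x \<in> ext_pts X" "x \<notin> B" for x
    using b(2)[of x] b(3)[OF that(1)] ab[OF that(1)] that by (simp add: v_def)
  ultimately show thesis using that by blast
qed

text \<open>On a grid of mesh \<open>e\<close> starting at \<open>- C\<close>, the function
  \<open>v i\<close> rises from 0 to 1 while \<open>f\<close> crosses from \<open>t i\<close> to
  \<open>t (Suc i)\<close>; the sum of these steps follows \<open>f\<close> up to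
  \<open>e\<close>.\<close>

lemma measurable_imp_extendable:
  assumes bdd: "bounded (f ` ext_pts X)"
    and meas: "family_measurable (ext_pts X) (positivity_sets X Mult) f"
  shows "extendable f"
proof (rule extendable_closed)
  fix e :: real assume e: "0 < e"
  obtain C where C: "\<And>x. x \<in> ext_pts X \<Longrightarrow> \<bar>f x\<bar> \<le> C"
    using bdd by (auto simp: bounded_iff)
  define t where "t i = - C + real i * e" for i
  have step: "\<exists>v. extendable v \<and> (\<forall>x\<in>ext_pts X. 0 \<le> v x \<and> v x \<le> 1 \<and>
      (f x \<le> t i \<longrightarrow> v x = 0) \<and> (t (Suc i) \<le> f x \<longrightarrow> v x = 1))" for i
  proof -
    have "{x \<in> ext_pts X. f x \<in> {t i<..}} \<in> positivity_sets X Mult"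
      "{x \<in> ext_pts X. f x \<in> {..<t (Suc i)}} \<in> positivity_sets X Mult"
      using meas open_greaterThan open_lessThan unfolding family_measurable_def by blast+
    moreover have "ext_pts X \<subseteq> {x \<in> ext_pts X. f x \<in> {t i<..}} \<union> {x \<in> ext_pts X. f x \<in> {..<t (Suc i)}}"
    proof
      fix x assume "x \<in> ext_pts X"
      moreover have "t i < t (Suc i)" using e by (simp add: t_def)
      then have "t i < f x \<or> f x < t (Suc i)" by linarith
      ultimately show "x \<in> {x \<in> ext_pts X. f x \<in> {t i<..}} \<union> {x \<in> ext_pts X. f x \<in> {..<t (Suc i)}}"
        by simp
    qed
    ultimately obtain v where "extendable v" "\<And>x. x \<in> ext_pts X \<Longrightarrow> 0 \<le> v x \<and> v x \<le> 1"
      "\<And>x. x \<in> ext_pts X \<Longrightarrow> x \<notin> {x \<in> ext_pts X. f x \<in> {t i<..}} \<Longrightarrow> v x = 0"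
      "\<And>x. x \<in> ext_pts X \<Longrightarrow> x \<notin> {x \<in> ext_pts X. f x \<in> {..<t (Suc i)}} \<Longrightarrow> v x = 1"
      by (rule extendable_separation) blast
    then show ?thesis by (intro exI[of _ v]) auto
  qed
  have "\<exists>v. \<forall>i. extendable (v i) \<and> (\<forall>x\<in>ext_pts X. 0 \<le> v i x \<and> v i x \<le> 1 \<and>
      (f x \<le> t i \<longrightarrow> v i x = 0) \<and> (t (Suc i) \<le> f x \<longrightarrow> v i x = 1))"
    by (rule choice) (use step in blast)
  then obtain v where v: "\<And>i. extendable (v i)" "\<And>i x. x \<in> ext_pts X \<Longrightarrow> 0 \<le> v i x \<and> v i x \<le> 1"
    "\<And>i x. x \<in> ext_pts X \<Longrightarrow> f x \<le> t i \<Longrightarrow> v i x = 0"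
    "\<And>i x. x \<in> ext_pts X \<Longrightarrow> t (Suc i) \<le> f x \<Longrightarrow> v i x = 1"
    by blast
  define S where "S n x = - C + e * (\<Sum>i<n. v i x)" for n x
  have S_Suc: "S (Suc n) x = S n x + e * v n x" for n x by (simp add: S_def distrib_left)
  have t_Suc: "t (Suc n) = t n + e" for n by (simp add: t_def algebra_simps)
  \<comment> \<open>Where \<open>f\<close> has reached level \<open>n\<close>, all earlier steps are
    complete and \<open>S n\<close> equals \<open>t n\<close>; elsewhere the error is already at
    most \<open>e\<close>, and later steps vanish.\<close>
  have S: "(t n \<le> f x \<longrightarrow> S n x = t n) \<and> (f x < t n \<longrightarrow> \<bar>S n x - f x\<bar> \<le> e)"
    if x: "x \<in> ext_pts X" for n x
  proof (induction n)
    case 0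
    then show ?case using C[OF x] by (simp add: S_def t_def abs_le_iff)
  next
    case (Suc n)
    have ev: "0 \<le> e * v n x" "e * v n x \<le> e" using v(2)[OF x, of n] e by auto
    consider "t (Suc n) \<le> f x" | "t n \<le> f x" "f x < t (Suc n)" | "f x < t n" by linarith
    then show ?case
    proof cases
      case 1
      then show ?thesis using Suc v(4)[OF x 1] e by (simp add: S_Suc t_Suc)
    next
      \<comment> \<open>Both \<open>f x\<close> and the new partial sum lie between
        \<open>t n\<close> and \<open>t n + e\<close>.\<close>
      case 2
      then have "\<bar>S n x + e * v n x - f x\<bar> \<le> e" using Suc ev t_Suc[of n] by linarith
      then show ?thesis using 2 by (simp add: S_Suc)
    next
      case 3
      then show ?thesis using Suc v(3)[OF x, of n] e by (simp add: S_Suc t_Suc)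
    qed
  qed
  \<comment> \<open>The grid passes \<open>C\<close>, so the error bound applies at every extreme
    point.\<close>
  obtain N where "2 * C / e < real N" using reals_Archimedean2 by blast
  then have "C < t N" using e by (simp add: t_def field_simps)
  then have "\<bar>S N x - f x\<bar> \<le> e" if "x \<in> ext_pts X" for x
    using S[OF that, of N] C[OF that] by auto
  moreover have "extendable (S N)"
    unfolding S_def by (intro extendable_add extendable_mult extendable_const extendable_sum v)
  ultimately show "\<exists>h. extendable h \<and> (\<forall>x\<in>ext_pts X. \<bar>h x - f x\<bar> \<le> e)" by blast
qed

end

section \<open>Multipliers and strong multipliers\<close>

theorem theorem8p11:
  fixes X :: "'a::hausdorff_lcs set" and H :: "('a \<Rightarrow> real) set"
  assumes "compact X" and "convex X"
    and "intermediate_function_space X H"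
    and "H = up H \<inter> down H"
    and "determined_by_extreme_points X (up H)"
  shows "(multipliers X H = up (multipliers X H) \<inter> down (multipliers X H) \<and>
          strong_multipliers X H = up (strong_multipliers X H) \<inter> down (strong_multipliers X H)) \<and>
         (\<forall>f::'a \<Rightarrow> real. bounded (f ` ext_pts X) \<longrightarrow>
            (extends_to (ext_pts X) (multipliers X H) f \<longleftrightarrow>
               family_measurable (ext_pts X) (positivity_sets X (multipliers X H)) f)) \<and>
         (\<forall>f::'a \<Rightarrow> real. bounded (f ` ext_pts X) \<longrightarrow>
            (extends_to (ext_pts X) (strong_multipliers X H) f \<longleftrightarrow>
               family_measurable (ext_pts X) (positivity_sets X (strong_multipliers X H)) f))"
proof -
  interpret determined_convex_space X H
    using assms by unfold_locales
  interpret M: multiplier_filter X H "principal (ext_pts X)"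
    by unfold_locales (auto simp: eventually_principal)
  \<comment> \<open>Eventually along this supremum means almost everywhere for each maximal
    measure.\<close>
  interpret S: multiplier_filter X H "Sup (ae_filter ` {\<mu>. maximal_measure X \<mu>})"
  proof unfold_locales
    fix P x
    assume "eventually P (Sup (ae_filter ` {\<mu>. maximal_measure X \<mu>}))" "x \<in> ext_pts X"
    \<comment> \<open>The Dirac measure at \<open>x\<close> is among the maximal measures, and its
      null sets miss \<open>x\<close>.\<close>
    moreover from this have "maximal_measure X (return (count_space X) x)"
      using assms by (intro maximal_measure_dirac) (auto simp: ext_pts_def)
    ultimately have "AE y in return (count_space X) x. P y"
      by (auto simp: eventually_Sup)
    then show "P x"
      using \<open>x \<in> ext_pts X\<close> ext_pts_subset by (subst (asm) AE_return) auto
  next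
    fix P :: "nat \<Rightarrow> 'a \<Rightarrow> bool"
    assume "\<And>n. eventually (P n) (Sup (ae_filter ` {\<mu>. maximal_measure X \<mu>}))"
    then show "eventually (\<lambda>x. \<forall>n. P n x) (Sup (ae_filter ` {\<mu>. maximal_measure X \<mu>}))"
      by (auto simp: eventually_Sup AE_all_countable)
  qed
  have M: "multipliers X H = M.Mult"
    by (simp add: multipliers_def M.Mult_def eventually_principal)
  have S: "strong_multipliers X H = S.Mult"
    by (simp add: strong_multipliers_def S.Mult_def eventually_Sup)
  show ?thesis
    unfolding M S
    using M.Mult_eq_up_down M.extendable_imp_measurable M.measurable_imp_extendable
      S.Mult_eq_up_down S.extendable_imp_measurable S.measurable_imp_extendable
    by blast
qed

end
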